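(* Let $p>1$, $t\geq 0$ be real numbers and let $r,s\in(0,1)$. Then \begin{enumerate} \item $\arcsin_p(M_t(r,s))\leq M_t(\arcsin_p(r),\arcsin_p(s))$, \item $\operatorname{artanh}_p(M_t(r,s))\leq M_t(\operatorname{artanh}_p(r),\operatorname{artanh}_p(s))$, \item $\arctan_p(M_t(r,s))\geq M_t(\arctan_p(r),\arctan_p(s))$, \item $\operatorname{arsinh}_p(M_t(r,s))\geq M_t(\operatorname{arsinh}_p(r),\operatorname{arsinh}_p(s))$. \end{enumerate}
   Context: For $t\in\mathbb{R}$ and $x,y>0$, the power mean of order $t$ is $M_t(x,y)=\left(\frac{x^t+y^t}{2}\right)^{1/t}$ if $t\neq 0$, and $M_0(x,y)=\sqrt{xy}$. For $p>1$ and $x\in(0,1)$ the generalized inverse trigonometric and hyperbolic functions are $$\arcsin_p x=\int_0^x(1-u^p)^{-1/p}\,du,\qquad \arctan_p x=\int_0^x(1+u^p)^{-1}\,du,$$ $$\operatorname{arsinh}_p x=\int_0^x(1+u^p)^{-1/p}\,du,\qquad \operatorname{artanh}_p x=\int_0^x(1-u^p)^{-1}\,du.$$ *)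

theory Defs
  imports "HOL-Analysis.Analysis"
begin

definition power_mean :: "real \<Rightarrow> real \<Rightarrow> real \<Rightarrow> real" where
  "power_mean t x y =
     (if t = 0 then sqrt (x * y) else ((x powr t + y powr t) / 2) powr (1 / t))"

text \<open>
  The functions below are intended for \<open>p > 1\<close> and \<open>0 < x < 1\<close>. There the integrands are
  continuous on \<open>{0..x}\<close> (with \<open>0 powr p = 0\<close> at the left endpoint), so the integrals exist.
\<close>

definition arcsin_p :: "real \<Rightarrow> real \<Rightarrow> real" where
  "arcsin_p p x = integral {0..x} (\<lambda>u. (1 - u powr p) powr (- 1 / p))"

definition arctan_p :: "real \<Rightarrow> real \<Rightarrow> real" where
  "arctan_p p x = integral {0..x} (\<lambda>u. inverse (1 + u powr p))"

definition arsinh_p :: "real \<Rightarrow> real \<Rightarrow> real" where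
  "arsinh_p p x = integral {0..x} (\<lambda>u. (1 + u powr p) powr (- 1 / p))"

definition artanh_p :: "real \<Rightarrow> real \<Rightarrow> real" where
  "artanh_p p x = integral {0..x} (\<lambda>u. inverse (1 - u powr p))"

end

theory Submission
  imports Defs
begin

text \<open>
  All four functions are \<open>f x = \<integral>\<^sub>0\<^sup>x g\<close> with \<open>g u = (1 + e u\<^sup>p) powr (-q)\<close> and \<open>e = \<plusminus>1\<close>.
  For \<open>t > 0\<close> the inequality is midpoint convexity (concavity for \<open>e = 1\<close>) of
  \<open>y \<mapsto> f (y powr (1/t)) powr t\<close>, whose derivative at \<open>y = x powr t\<close> is
  \<open>(f x / x) powr (t - 1) * g x = (x g x / f x) powr (1 - t) * g x powr t\<close>; for \<open>t = 0\<close> it is that of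
  \<open>v \<mapsto> ln (f (exp v))\<close>, with derivative \<open>x g x / f x\<close>. Writing \<open>f x / x = \<integral>\<^sub>0\<^sup>1 g (x u) du\<close>,
  the functions \<open>g\<close>, \<open>f x / x\<close> and \<open>x g x / f x\<close> are all monotone in the same direction, the
  last because \<open>g x / g (x u)\<close> is so in \<open>x\<close> for every \<open>u \<in> [0,1]\<close>. The first form of the
  derivative serves for \<open>t \<ge> 1\<close> and the second for \<open>t \<le> 1\<close>.
  A sign \<open>c = -e\<close> treats the increasing and the decreasing case simultaneously.
\<close>

section \<open>Order and convexity tools\<close>

lemma signed_mult_mono:
  fixes a b c :: real
  assumes "c \<in> {1, -1}" "c * a \<le> c * a'" "c * b \<le> c * b'" "0 < a" "0 < a'" "0 < b" "0 < b'"
  shows "c * (a * b) \<le> c * (a' * b')"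
  using assms mult_mono[of a a' b b'] mult_mono[of a' a b' b] by auto

lemma signed_powr_mono:
  fixes a c k :: real
  assumes "c \<in> {1, -1}" "c * a \<le> c * a'" "0 < a" "0 < a'" "0 \<le> k"
  shows "c * a powr k \<le> c * a' powr k"
  using assms powr_mono2[of k a a'] powr_mono2[of k a' a] by auto

lemma convex_midpoint:
  fixes h :: "real \<Rightarrow> real"
  assumes "convex_on A h" "x \<in> A" "y \<in> A"
  shows "h ((x + y) / 2) \<le> (h x + h y) / 2"
  using convex_onD[OF assms(1), of "1/2" x y] assms(2,3) by (simp add: field_simps)

section \<open>From monotone derivatives to mean inequalities\<close>

text \<open>The substitution \<open>y = x powr t\<close> turns power means of arguments and of
  values into midpoints. Of the quotients, \<open>mono_quot\<close> serves \<open>t \<ge> 1\<close>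
  and \<open>mono_log\<close> serves \<open>t < 1\<close>.\<close>

lemma power_mean_signed_convex_pos:
  fixes f g :: "real \<Rightarrow> real"
  assumes c: "c \<in> {1, -1}" and t: "0 < t"
    and der: "\<And>x. x \<in> {0<..<1} \<Longrightarrow> (f has_real_derivative g x) (at x)"
    and fpos: "\<And>x. x \<in> {0<..<1} \<Longrightarrow> 0 < f x"
    and gpos: "\<And>x. x \<in> {0<..<1} \<Longrightarrow> 0 < g x"
    and mono_g: "mono_on {0<..<1} (\<lambda>x. c * g x)"
    and mono_quot: "mono_on {0<..<1} (\<lambda>x. c * (f x / x))"
    and mono_log: "mono_on {0<..<1} (\<lambda>x. c * (x * g x / f x))"
    and r: "r \<in> {0<..<1}" and s: "s \<in> {0<..<1}"
  shows "c * f (power_mean t r s) \<le> c * power_mean t (f r) (f s)"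
proof -
  \<comment> \<open>The derivative of \<open>f (y powr (1 / t)) powr t\<close> in \<open>y\<close>,
    expressed through \<open>x = y powr (1 / t)\<close>; the factors \<open>t\<close> and
    \<open>1 / t\<close> cancel.\<close>
  define H where "H x = (f x / x) powr (t - 1) * g x" for x
  have pos: "0 < f x" "0 < g x" "0 < x" if "x \<in> {0<..<1}" for x
    using that fpos gpos by auto
  have H_mono: "c * H x \<le> c * H y" if xy: "x \<in> {0<..<1}" "y \<in> {0<..<1}" "x \<le> y" for x y
  proof (cases "t \<ge> 1")
    case True
    show ?thesis
      unfolding H_def
      using True pos[OF xy(1)] pos[OF xy(2)] mono_onD[OF mono_g xy] mono_onD[OF mono_quot xy] c
      by (intro signed_mult_mono signed_powr_mono) simp_all
  next
    case False
    \<comment> \<open>Here \<open>t - 1\<close> is negative, so \<open>f x / x\<close> would push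
      the wrong way; regrouping leaves only the nonnegative exponents \<open>1 - t\<close> and
      \<open>t\<close>.\<close>
    have eq: "H z = (z * g z / f z) powr (1 - t) * g z powr t" if "z \<in> {0<..<1}" for z
    proof -
      have "0 < z" "0 < f z" "0 < g z" using pos[OF that] by auto
      then have "H z = exp ((t - 1) * (ln (f z) - ln z) + ln (g z))"
        "(z * g z / f z) powr (1 - t) * g z powr t
          = exp ((1 - t) * (ln z + ln (g z) - ln (f z)) + t * ln (g z))"
        unfolding H_def by (simp_all add: powr_def ln_div ln_mult exp_add)
      then show ?thesis by (simp add: algebra_simps)
    qed
    show ?thesis
      unfolding eq[OF xy(1)] eq[OF xy(2)]
      using False t pos[OF xy(1)] pos[OF xy(2)] mono_onD[OF mono_g xy] mono_onD[OF mono_log xy] c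
      by (intro signed_mult_mono signed_powr_mono) simp_all
  qed
  have root_in: "y powr (1 / t) \<in> {0<..<1}" if "y \<in> {0<..<1}" for y
    using that t powr_less_mono2[of "1/t" y 1] by auto
  have conv: "convex_on {0<..<1} (\<lambda>y. c * f (y powr (1 / t)) powr t)"
  proof (rule convex_on_realI)
    fix y :: real assume y: "y \<in> {0<..<1}"
    define x where "x = y powr (1 / t)"
    have x: "x \<in> {0<..<1}" using root_in[OF y] by (simp add: x_def)
    have "((\<lambda>y. c * f (y powr (1 / t)) powr t) has_real_derivative
        c * (t * f x powr (t - 1) * (g x * (1 / t * y powr (1 / t - 1))))) (at y)"
      unfolding x_def using y root_in[OF y] fpos[OF root_in[OF y]]
      by (intro DERIV_cmult DERIV_chain'[OF DERIV_chain'[OF has_real_derivative_powr der]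
            has_real_derivative_powr, THEN DERIV_cong]) auto
    moreover have "y powr (1 / t - 1) = x powr (1 - t)"
      using t y by (simp add: x_def powr_powr field_simps)
    moreover have "f x powr (t - 1) * x powr (1 - t) = (f x / x) powr (t - 1)"
      using x fpos[OF x] powr_minus_divide[of x "t - 1"] by (simp add: powr_divide)
    ultimately show "((\<lambda>y. c * f (y powr (1 / t)) powr t) has_real_derivative
        c * H (y powr (1 / t))) (at y)"
      using t unfolding H_def x_def[symmetric] by (simp add: mult_ac)
  next
    fix x y :: real assume "x \<in> {0<..<1}" "y \<in> {0<..<1}" "x \<le> y"
    then show "c * H (x powr (1 / t)) \<le> c * H (y powr (1 / t))"
      using t root_in by (intro H_mono powr_mono2) auto
  qed auto
  have pow_in: "z powr t \<in> {0<..<1}" if "z \<in> {0<..<1}" for z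
    using that t powr_less_mono2[of t z 1] by auto
  define m where "m = power_mean t r s"
  have m: "m = ((r powr t + s powr t) / 2) powr (1 / t)" using t by (simp add: m_def power_mean_def)
  have "m \<in> {0<..<1}"
    unfolding m using pow_in[OF r] pow_in[OF s] by (intro root_in) (simp add: add_pos_pos)
  then have fm: "0 < f m" by (rule fpos)
  have frs: "0 < f r" "0 < f s" using fpos r s by auto
  \<comment> \<open>\<open>m powr t\<close> is the midpoint of \<open>r powr t\<close> and
    \<open>s powr t\<close>.\<close>
  have "c * f m powr t \<le> c * ((f r powr t + f s powr t) / 2)"
    using convex_midpoint[OF conv pow_in[OF r] pow_in[OF s]] t r s
    by (simp add: m powr_powr field_simps)
  then have "c * (f m powr t) powr (1 / t) \<le> c * ((f r powr t + f s powr t) / 2) powr (1 / t)"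
    using c t fm frs by (intro signed_powr_mono) (auto intro: add_pos_pos)
  then show ?thesis
    using t fm by (simp add: m_def[symmetric] powr_powr) (simp add: power_mean_def)
qed

text \<open>The logarithm replaces the \<open>t\<close>-th power: it carries \<open>{0<..<1}\<close>
  onto \<open>{..<0}\<close> and geometric means to midpoints, for arguments and values
  alike.\<close>

lemma geometric_mean_signed_convex:
  fixes f g :: "real \<Rightarrow> real"
  assumes c: "c \<in> {1, -1}"
    and der: "\<And>x. x \<in> {0<..<1} \<Longrightarrow> (f has_real_derivative g x) (at x)"
    and fpos: "\<And>x. x \<in> {0<..<1} \<Longrightarrow> 0 < f x"
    and mono_log: "mono_on {0<..<1} (\<lambda>x. c * (x * g x / f x))"
    and r: "r \<in> {0<..<1}" and s: "s \<in> {0<..<1}"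
  shows "c * f (power_mean 0 r s) \<le> c * power_mean 0 (f r) (f s)"
proof -
  have conv: "convex_on {..<0} (\<lambda>v. c * ln (f (exp v)))"
  proof (rule convex_on_realI)
    fix v :: real assume v: "v \<in> {..<0}"
    then have e: "exp v \<in> {0<..<1}" by simp
    show "((\<lambda>v. c * ln (f (exp v))) has_real_derivative c * (exp v * g (exp v) / f (exp v))) (at v)"
      using fpos[OF e]
      by (auto intro!: derivative_eq_intros DERIV_chain'[OF DERIV_exp der[OF e]])
  next
    fix v w :: real assume "v \<in> {..<0}" "w \<in> {..<0}" "v \<le> w"
    then show "c * (exp v * g (exp v) / f (exp v)) \<le> c * (exp w * g (exp w) / f (exp w))"
      by (intro mono_onD[OF mono_log]) auto
  qed auto
  have sqrt_exp: "sqrt (x * y) = exp ((ln x + ln y) / 2)" if "0 < x" "0 < y" for x y :: real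
  proof (rule real_sqrt_unique)
    have "exp ((ln x + ln y) / 2) ^ 2 = exp (ln x + ln y)"
      by (simp add: power2_eq_square flip: exp_add)
    then show "exp ((ln x + ln y) / 2) ^ 2 = x * y" using that by (simp add: exp_add)
  qed simp
  define m where "m = power_mean 0 r s"
  have m: "m = exp ((ln r + ln s) / 2)" using r s by (simp add: m_def power_mean_def sqrt_exp)
  have "m \<in> {0<..<1}" using r s by (auto simp: m intro: add_neg_neg)
  then have fm: "0 < f m" by (rule fpos)
  have frs: "0 < f r" "0 < f s" using fpos r s by auto
  have "c * ln (f m) \<le> c * ((ln (f r) + ln (f s)) / 2)"
    using convex_midpoint[OF conv, of "ln r" "ln s"] r s by (simp add: m field_simps)
  then have "c * exp (ln (f m)) \<le> c * exp ((ln (f r) + ln (f s)) / 2)"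
    using c by auto
  then show ?thesis
    using fm frs by (simp add: m_def[symmetric]) (simp add: sqrt_exp power_mean_def)
qed

section \<open>Integrals with variable upper limit\<close>

text \<open>Stretching \<open>{0..x}\<close> to \<open>{0..1}\<close> fixes the domain of
  integration, so the monotonicity of both quotients reduces to a comparison of integrands at each
  \<open>u\<close>.\<close>

lemma power_mean_signed_integral:
  fixes g :: "real \<Rightarrow> real"
  assumes c: "c \<in> {1, -1}" and t: "0 \<le> t"
    and cont: "continuous_on {0..<1} g"
    and gpos: "\<And>x. x \<in> {0..<1} \<Longrightarrow> 0 < g x"
    and mono_g: "mono_on {0..<1} (\<lambda>x. c * g x)"
    and mono_ratio: "\<And>u. u \<in> {0..1} \<Longrightarrow> mono_on {0<..<1} (\<lambda>x. c * (g x / g (x * u)))"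
    and r: "r \<in> {0<..<1}" and s: "s \<in> {0<..<1}"
  shows "c * integral {0..power_mean t r s} g \<le>
    c * power_mean t (integral {0..r} g) (integral {0..s} g)"
proof -
  define f where "f x = integral {0..x} g" for x
  define F where "F x = integral {0..1} (\<lambda>u. g (x * u))" for x
  have mul_in: "x * u \<in> {0..<1}" if "x \<in> {0<..<1}" "u \<in> {0..1}" for x u :: real
    using that by (auto intro: le_less_trans[OF mult_left_le[of u x]])
  have int: "(\<lambda>u. g (x * u)) integrable_on {0..1}" if "x \<in> {0<..<1}" for x
    by (intro integrable_continuous_real continuous_on_compose2[OF cont] continuous_intros)
      (use mul_in[OF that] in auto)
  have der: "(f has_real_derivative g x) (at x)" if x: "x \<in> {0<..<1}" for x
  proof -
    \<comment> \<open>The midpoint of \<open>x\<close> and \<open>1\<close> keeps the compact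
      interval inside \<open>{0..<1}\<close> and has \<open>x\<close> in its interior.\<close>
    have "continuous_on {0..(1 + x) / 2} g"
      using x by (intro continuous_on_subset[OF cont]) auto
    then have "(f has_real_derivative g x) (at x within {0..(1 + x) / 2})"
      unfolding f_def using x by (intro integral_has_real_derivative) auto
    moreover have "x \<in> interior {0..(1 + x) / 2}" using x by auto
    ultimately show ?thesis by (simp only: at_within_interior)
  qed
  have fF: "f x = x * F x" if x: "x \<in> {0<..<1}" for x
  proof -
    have "g integrable_on {0..x}"
      using x by (intro integrable_continuous_real continuous_on_subset[OF cont]) auto
    then have "(g has_integral f x) {0..x}" unfolding f_def by (rule integrable_integral)
    moreover have "(\<lambda>y. y / x) ` {0..x} = {0..1}"
      using x image_divide_atLeastAtMost[of x 0 x] by simp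
    ultimately have "((\<lambda>u. g (x * u)) has_integral (f x / x)) {0..1}"
      using has_integral_stretch_real[of g "f x" 0 x x] x by simp
    then show ?thesis using x by (simp add: F_def integral_unique)
  qed
  have Fpos: "0 < F x" if x: "x \<in> {0<..<1}" for x
  proof -
    have "continuous_on {0..1} (\<lambda>u. g (x * u))"
      by (intro continuous_on_compose2[OF cont] continuous_intros) (use mul_in[OF x] in auto)
    then show ?thesis
      unfolding F_def using gpos mul_in[OF x]
      by (intro integral_less_real[where f = "\<lambda>_. 0", simplified]) auto
  qed
  have fpos: "0 < f x" if "x \<in> {0<..<1}" for x using fF[OF that] Fpos[OF that] that by simp
  have monog: "mono_on {0<..<1} (\<lambda>x. c * g x)"
    by (rule mono_on_subset[OF mono_g]) auto
  have mono_quot: "mono_on {0<..<1} (\<lambda>x. c * (f x / x))"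
  proof (rule mono_onI)
    fix x y :: real assume xy: "x \<in> {0<..<1}" "y \<in> {0<..<1}" "x \<le> y"
    have "integral {0..1} (\<lambda>u. c * g (x * u)) \<le> integral {0..1} (\<lambda>u. c * g (y * u))"
      using xy mul_in int
      by (intro integral_le integrable_on_mult_right mono_onD[OF mono_g] mult_right_mono) auto
    then show "c * (f x / x) \<le> c * (f y / y)" using xy by (simp add: fF F_def)
  qed
  have mono_log: "mono_on {0<..<1} (\<lambda>x. c * (x * g x / f x))"
  proof (rule mono_onI)
    fix x y :: real assume xy: "x \<in> {0<..<1}" "y \<in> {0<..<1}" "x \<le> y"
    have g: "0 < g x" "0 < g y" using gpos xy by auto
    \<comment> \<open>Since \<open>x * g x / f x = g x / F x\<close>, cross-multiplying gives an
      inequality linear in \<open>F\<close>, which can be checked under the integral.\<close>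
    have "integral {0..1} (\<lambda>u. c * g x * g (y * u)) \<le> integral {0..1} (\<lambda>u. c * g y * g (x * u))"
    proof (intro integral_le integrable_on_mult_right int xy)
      fix u :: real assume u: "u \<in> {0..1}"
      have "0 < g (x * u)" "0 < g (y * u)" using gpos mul_in xy u by auto
      moreover have "c * (g x / g (x * u)) \<le> c * (g y / g (y * u))"
        using mono_onD[OF mono_ratio[OF u]] xy by auto
      ultimately show "c * g x * g (y * u) \<le> c * g y * g (x * u)"
        using c by (auto simp: field_simps)
    qed
    then have "c * g x * F y \<le> c * g y * F x" by (simp add: F_def)
    then show "c * (x * g x / f x) \<le> c * (y * g y / f y)"
      using xy Fpos[OF xy(1)] Fpos[OF xy(2)] c by (auto simp: fF field_simps)
  qed
  have "c * f (power_mean t r s) \<le> c * power_mean t (f r) (f s)"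
  proof (cases "t = 0")
    case True
    then show ?thesis
      using geometric_mean_signed_convex[OF c der fpos mono_log r s] by simp
  next
    case False
    then show ?thesis
      using power_mean_signed_convex_pos[OF c _ der fpos _ monog mono_quot mono_log r s] t gpos
      by auto
  qed
  then show ?thesis by (simp add: f_def)
qed

section \<open>The concrete integrands\<close>

text \<open>The integrand increases for \<open>e = -1\<close> and decreases for
  \<open>e = 1\<close>, hence the sign \<open>c = - e\<close>. Giving \<open>g\<close> by an
  equation on \<open>{0..<1}\<close> admits integrands written with \<open>inverse\<close>.\<close>

lemma power_mean_integral_binomial_powr:
  fixes p q e t r s :: real
  assumes p: "0 < p" and q: "0 < q" and e: "e \<in> {1, -1}" and t: "0 \<le> t"
    and r: "r \<in> {0<..<1}" and s: "s \<in> {0<..<1}"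
    and g: "\<And>u. u \<in> {0..<1} \<Longrightarrow> g u = (1 + e * u powr p) powr (- q)"
  shows "e * power_mean t (integral {0..r} g) (integral {0..s} g)
    \<le> e * integral {0..power_mean t r s} g"
proof -
  have less1: "x powr p < 1" if "x \<in> {0..<1}" for x
    using that p powr_less_mono2[of p x 1] by auto
  have base: "0 < 1 + e * x powr p" if "x \<in> {0..<1}" for x
    using less1[OF that] e by (auto intro: add_pos_nonneg)
  have neg: "-e \<in> {1, -1}" using e by auto
  have powr_q: "- e * a powr (- q) \<le> - e * b powr (- q)" if "0 < a" "0 < b" "e * a \<le> e * b" for a b
    using that e q powr_mono2'[of "-q" a b] powr_mono2'[of "-q" b a] by auto
  have "- e * integral {0..power_mean t r s} g \<le>
    - e * power_mean t (integral {0..r} g) (integral {0..s} g)"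
  proof (rule power_mean_signed_integral[OF neg t _ _ _ _ r s])
    have "continuous_on {0..<1} (\<lambda>u. (1 + e * u powr p) powr (- q))"
      using p base
      by (intro continuous_on_powr' continuous_intros) (force simp: less_imp_le)+
    then show "continuous_on {0..<1} g"
      using continuous_on_cong[OF refl g, of "{0..<1}" "\<lambda>u. u"] by simp
    show "0 < g x" if "x \<in> {0..<1}" for x
      using base[OF that] by (simp add: g[OF that])
    show "mono_on {0..<1} (\<lambda>x. - e * g x)"
    proof (rule mono_onI)
      fix x y :: real assume xy: "x \<in> {0..<1}" "y \<in> {0..<1}" "x \<le> y"
      have "x powr p \<le> y powr p" using xy p by (intro powr_mono2) auto
      then show "- e * g x \<le> - e * g y"
        unfolding g[OF xy(1)] g[OF xy(2)] using e by (intro powr_q base xy) auto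
    qed
    show "mono_on {0<..<1} (\<lambda>x. - e * (g x / g (x * u)))" if u: "u \<in> {0..1}" for u
    proof (rule mono_onI)
      fix x y :: real assume xy: "x \<in> {0<..<1}" "y \<in> {0<..<1}" "x \<le> y"
      define a b k where "a = x powr p" and "b = y powr p" and "k = u powr p"
      have ab: "a \<le> b" "0 \<le> k" "k \<le> 1"
        using xy p u powr_mono2[of p u 1] by (auto simp: a_def b_def k_def intro: powr_mono2)
      have in01: "z * u \<in> {0..<1}" if "z \<in> {0<..<1}" for z
        using that u by (auto intro: le_less_trans[OF mult_left_le[of u z]])
      have powr_mult': "(z * u) powr p = z powr p * k" if "z \<in> {0<..<1}" for z
        using that u by (simp add: powr_mult k_def)
      have pos: "0 < 1 + e * a" "0 < 1 + e * b" "0 < 1 + e * (a * k)" "0 < 1 + e * (b * k)"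
        using base[of x] base[of y] base[OF in01[OF xy(1)]] base[OF in01[OF xy(2)]] xy
        by (auto simp: a_def b_def powr_mult')
      \<comment> \<open>Cross-multiplied, the two sides of the next inequality differ by
        \<open>(b - a) * (1 - k)\<close>, because \<open>e * e = 1\<close>.\<close>
      have "a * (1 - k) \<le> b * (1 - k)" using ab by (intro mult_right_mono) auto
      then have "e * ((1 + e * b) / (1 + e * (b * k))) \<ge> e * ((1 + e * a) / (1 + e * (a * k)))"
        using pos e by (auto simp: field_simps)
      then have "- e * ((1 + e * a) / (1 + e * (a * k))) powr (- q)
          \<le> - e * ((1 + e * b) / (1 + e * (b * k))) powr (- q)"
        using pos by (intro powr_q) auto
      then show "- e * (g x / g (x * u)) \<le> - e * (g y / g (y * u))"
        using pos xy in01[OF xy(1)] in01[OF xy(2)] by (simp add: g powr_mult' powr_divide a_def[symmetric] b_def[symmetric])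
    qed
  qed
  then show ?thesis by simp
qed

theorem theorem1p1:
  fixes p t r s :: real
  assumes "p > 1" and "t \<ge> 0"
    and "r \<in> {0<..<1}" and "s \<in> {0<..<1}"
  shows "arcsin_p p (power_mean t r s) \<le> power_mean t (arcsin_p p r) (arcsin_p p s) \<and>
         artanh_p p (power_mean t r s) \<le> power_mean t (artanh_p p r) (artanh_p p s) \<and>
         arctan_p p (power_mean t r s) \<ge> power_mean t (arctan_p p r) (arctan_p p s) \<and>
         arsinh_p p (power_mean t r s) \<ge> power_mean t (arsinh_p p r) (arsinh_p p s)"
proof -
  \<comment> \<open>At \<open>x = 0\<close> both sides are \<open>0\<close> by convention, so the
    weak bound \<open>le1\<close> is enough to rewrite
    \<open>inverse (1 - u powr p)\<close>.\<close>
  have inv: "inverse x = x powr (- 1)" if "0 \<le> x" for x :: real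
    using that by (simp add: powr_minus)
  have le1: "u powr p \<le> 1" if "u \<in> {0..<1}" for u
    using that assms(1) powr_mono2[of p u 1] by auto
  have p: "0 < p" using assms(1) by simp
  note * = power_mean_integral_binomial_powr[OF p _ _ assms(2-4)]
  show ?thesis
    using *[of "1 / p" "-1" "\<lambda>u. (1 - u powr p) powr (- 1 / p)"]
      *[of 1 "-1" "\<lambda>u. inverse (1 - u powr p)"]
      *[of 1 1 "\<lambda>u. inverse (1 + u powr p)"]
      *[of "1 / p" 1 "\<lambda>u. (1 + u powr p) powr (- 1 / p)"]
      p le1
    by (simp add: arcsin_p_def artanh_p_def arctan_p_def arsinh_p_def inv)
qed

end
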